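(* Let $G_1,G,H$ be groups of nilpotence class two. Any composite of q-maps is a q-map. More precisely, for q-maps $f:G\to H$ and $g:G_1\to G$, the composite $fg:G_1\to H$ is a q-map and its cross-effect is given by $$(a\mid b)_{fg}=f\big((a\mid b)_g\big)+\big(g(a)\mid g(b)\big)_f,\qquad a,b\in G_1 .$$
   Context: Groups are written additively; $[a,b]=-a-b+a+b$. A group $G$ is of nilpotence class two (a nil$_2$-group) if $[[G,G],G]=0$. For a map $f:G\to H$ of groups put $(a\mid b)_f:=-(f(a)+f(b))+f(a+b)$ (the cross-effect). The map $f$ is weakly quadratic if for all $a,b,c\in G$ the element $(a\mid b)_f$ commutes with $f(c)$ and $(a\mid b)_f$ is linear (additive) in $a$ and in $b$. A weakly quadratic map $f:G\to H$ between nil$_2$-groups is a q-map if $(a\mid b)_f\in[H,H]$ for all $a,b\in G$. *)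

theory Defs
  imports "HOL-Algebra.Generated_Groups"
begin

text \<open>
  Groups are those of HOL-Algebra, so the additively written (but in general
  non-commutative) group operations \<open>a + b\<close>, \<open>- a\<close>, \<open>0\<close> appear here
  as \<open>a \<otimes> b\<close>, \<open>inv a\<close>, \<open>\<one>\<close>.
\<close>

text \<open>\<open>[a, b] = - a - b + a + b\<close>\<close>

definition commutator :: "('a, 'm) monoid_scheme \<Rightarrow> 'a \<Rightarrow> 'a \<Rightarrow> 'a" where
  "commutator G a b = inv\<^bsub>G\<^esub> a \<otimes>\<^bsub>G\<^esub> inv\<^bsub>G\<^esub> b \<otimes>\<^bsub>G\<^esub> a \<otimes>\<^bsub>G\<^esub> b"

definition commutator_subgroup :: "('a, 'm) monoid_scheme \<Rightarrow> 'a set \<Rightarrow> 'a set \<Rightarrow> 'a set" where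
  "commutator_subgroup G A B = generate G {commutator G a b | a b. a \<in> A \<and> b \<in> B}"

text \<open>
  The library's \<^const>\<open>derived\<close> subgroup is generated by the elements
  \<open>a + b - a - b\<close>; on the whole group both conventions give \<open>[G, G]\<close>.
\<close>

lemma (in group) commutator_subgroup_carrier_eq_derived:
  "commutator_subgroup G (carrier G) (carrier G) = derived G (carrier G)"
proof -
  have "{commutator G a b | a b. a \<in> carrier G \<and> b \<in> carrier G} = derived_set G (carrier G)"
    (is "?L = ?R")
  proof
    show "?L \<subseteq> ?R"
    proof
      fix x assume "x \<in> ?L"
      then obtain a b where ab: "a \<in> carrier G" "b \<in> carrier G" and x: "x = commutator G a b"
        by blast
      have "x = inv a \<otimes> inv b \<otimes> inv (inv a) \<otimes> inv (inv b)"
        using ab x by (simp add: commutator_def)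
      with ab show "x \<in> ?R" by (blast intro: inv_closed)
    qed
    show "?R \<subseteq> ?L"
    proof
      fix x assume "x \<in> ?R"
      then obtain a b where ab: "a \<in> carrier G" "b \<in> carrier G"
        and x: "x = a \<otimes> b \<otimes> inv a \<otimes> inv b"
        by blast
      have "x = commutator G (inv a) (inv b)"
        using ab x by (simp add: commutator_def)
      with ab show "x \<in> ?L" by (blast intro: inv_closed)
    qed
  qed
  then show ?thesis
    by (simp only: commutator_subgroup_def derived_def)
qed

text \<open>Class two means class at most two: abelian groups are included.\<close>

definition nil2_group :: "('a, 'm) monoid_scheme \<Rightarrow> bool" where
  "nil2_group G \<longleftrightarrow> group G \<and>
     commutator_subgroup G (commutator_subgroup G (carrier G) (carrier G)) (carrier G) = {\<one>\<^bsub>G\<^esub>}"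

text \<open>\<open>(a | b)\<^sub>f = - (f a + f b) + f (a + b)\<close>\<close>

definition cross_effect ::
  "('a, 'm) monoid_scheme \<Rightarrow> ('b, 'n) monoid_scheme \<Rightarrow> ('a \<Rightarrow> 'b) \<Rightarrow> 'a \<Rightarrow> 'a \<Rightarrow> 'b" where
  "cross_effect G H f a b = inv\<^bsub>H\<^esub> (f a \<otimes>\<^bsub>H\<^esub> f b) \<otimes>\<^bsub>H\<^esub> f (a \<otimes>\<^bsub>G\<^esub> b)"

definition weakly_quadratic ::
  "('a, 'm) monoid_scheme \<Rightarrow> ('b, 'n) monoid_scheme \<Rightarrow> ('a \<Rightarrow> 'b) \<Rightarrow> bool" where
  "weakly_quadratic G H f \<longleftrightarrow>
     f \<in> carrier G \<rightarrow> carrier H \<and>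
     (\<forall>a\<in>carrier G. \<forall>b\<in>carrier G. \<forall>c\<in>carrier G.
        cross_effect G H f a b \<otimes>\<^bsub>H\<^esub> f c = f c \<otimes>\<^bsub>H\<^esub> cross_effect G H f a b) \<and>
     (\<forall>b\<in>carrier G. (\<lambda>a. cross_effect G H f a b) \<in> hom G H) \<and>
     (\<forall>a\<in>carrier G. (\<lambda>b. cross_effect G H f a b) \<in> hom G H)"

definition q_map ::
  "('a, 'm) monoid_scheme \<Rightarrow> ('b, 'n) monoid_scheme \<Rightarrow> ('a \<Rightarrow> 'b) \<Rightarrow> bool" where
  "q_map G H f \<longleftrightarrow>
     weakly_quadratic G H f \<and>
     (\<forall>a\<in>carrier G. \<forall>b\<in>carrier G.
        cross_effect G H f a b \<in> commutator_subgroup H (carrier H) (carrier H))"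

end

theory Submission
  imports Defs
begin

text \<open>
  The cross-effect of a q-map \<open>f : G \<rightarrow> H\<close> is bilinear with values in the central subgroup
  \<open>[H, H]\<close>, so it vanishes as soon as one argument lies in \<open>[G, G]\<close>. Hence
  \<open>f (x + z) = f x + f z\<close> for \<open>z \<in> [G, G]\<close>; applied to \<open>a + b = b + a + [a, b]\<close> this gives
  \<open>f [a, b] = [f a, f b] + (a | b)\<^sub>f - (b | a)\<^sub>f\<close>, so that \<open>f\<close> restricts to a homomorphism
  \<open>[G, G] \<rightarrow> [H, H]\<close>. Expanding \<open>f (g a + g b + (a | b)\<^sub>g)\<close> yields the formula for the cross-effect
  of \<open>f g\<close>, and each of its two terms is bilinear.
\<close>

lemma (in group) commutator_closed [simp, intro]:
  "a \<in> carrier G \<Longrightarrow> b \<in> carrier G \<Longrightarrow> commutator G a b \<in> carrier G"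
  by (simp add: commutator_def)

lemma (in group) commutator_eq_one_iff:
  assumes "a \<in> carrier G" "b \<in> carrier G"
  shows "commutator G a b = \<one> \<longleftrightarrow> a \<otimes> b = b \<otimes> a"
proof -
  have "commutator G a b = inv (b \<otimes> a) \<otimes> (a \<otimes> b)"
    using assms by (simp add: commutator_def inv_mult_group m_assoc)
  then show ?thesis
    using assms by (metis inv_closed inv_comm inv_equality inv_inv m_closed l_inv)
qed

lemma (in group) mult_eq_mult_commutator:
  assumes "a \<in> carrier G" "b \<in> carrier G"
  shows "a \<otimes> b = b \<otimes> a \<otimes> commutator G a b"
proof -
  have "commutator G a b = inv (b \<otimes> a) \<otimes> (a \<otimes> b)"
    using assms by (simp add: commutator_def inv_mult_group m_assoc)
  then show ?thesis
    using assms by (simp add: inv_solve_left)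
qed

lemma (in group) commutator_subgroup_is_subgroup:
  assumes "A \<subseteq> carrier G" "B \<subseteq> carrier G"
  shows "subgroup (commutator_subgroup G A B) G"
  unfolding commutator_subgroup_def
  by (rule generate_is_subgroup) (use assms in auto)

text \<open>Stands in for induction over generated elements; it is applied to a kernel and to the
  set of elements of \<open>DG\<close> that \<open>f\<close> sends into \<open>DH\<close>.\<close>

lemma (in group) commutator_subgroup_least:
  assumes "subgroup K G"
    and "\<And>a b. a \<in> A \<Longrightarrow> b \<in> B \<Longrightarrow> commutator G a b \<in> K"
  shows "commutator_subgroup G A B \<subseteq> K"
  unfolding commutator_subgroup_def
  by (rule generate_subgroup_incl) (use assms in auto)

lemma commutator_in_commutator_subgroup:
  "a \<in> A \<Longrightarrow> b \<in> B \<Longrightarrow> commutator G a b \<in> commutator_subgroup G A B"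
  unfolding commutator_subgroup_def by (blast intro: generate.incl)

lemma nil2_group_is_group: "nil2_group G \<Longrightarrow> group G"
  by (simp add: nil2_group_def)

text \<open>Each \<open>commutator G z x\<close> is a generator of \<open>[[G, G], G]\<close>, which
  is trivial.\<close>

lemma nil2_group_central:
  assumes "nil2_group G"
    and z: "z \<in> commutator_subgroup G (carrier G) (carrier G)" and x: "x \<in> carrier G"
  shows "z \<otimes>\<^bsub>G\<^esub> x = x \<otimes>\<^bsub>G\<^esub> z"
proof -
  interpret group G by (rule nil2_group_is_group) fact
  have "z \<in> carrier G"
    using z commutator_subgroup_is_subgroup[of "carrier G" "carrier G"]
    by (auto dest: subgroup.subset)
  moreover have "commutator G z x = \<one>\<^bsub>G\<^esub>"
    using assms commutator_in_commutator_subgroup[OF z x, of G] by (simp add: nil2_group_def)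
  ultimately show ?thesis
    using x by (simp add: commutator_eq_one_iff)
qed

text \<open>Commutativity is asked only of the values of \<open>h\<close>: the target will be a
  group that need not be abelian, and \<open>h\<close> a cross-effect with one argument fixed, whose
  values are central.\<close>

lemma (in group_hom) commutator_subgroup_subset_kernel:
  assumes comm: "\<And>a b. a \<in> carrier G \<Longrightarrow> b \<in> carrier G \<Longrightarrow> h a \<otimes>\<^bsub>H\<^esub> h b = h b \<otimes>\<^bsub>H\<^esub> h a"
  shows "commutator_subgroup G (carrier G) (carrier G) \<subseteq> kernel G H h"
proof (rule G.commutator_subgroup_least)
  show "subgroup (kernel G H h) G"
    by (rule subgroup_kernel)
  fix a b assume ab: "a \<in> carrier G" "b \<in> carrier G"
  then have "h (commutator G a b) = commutator H (h a) (h b)"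
    by (simp add: commutator_def)
  also have "\<dots> = \<one>\<^bsub>H\<^esub>"
    using ab comm by (simp add: H.commutator_eq_one_iff)
  finally show "commutator G a b \<in> kernel G H h"
    using ab by (simp add: kernel_def)
qed

text \<open>One setting for both maps: the theorem instantiates it with \<open>g\<close> and with
  \<open>f\<close>.\<close>

locale nil2_q_map = G: group G + H: group H
  for G :: "('a, 'm) monoid_scheme"
    and H :: "('b, 'n) monoid_scheme" +
  fixes f :: "'a \<Rightarrow> 'b"
  assumes nil2: "nil2_group H" and q_map: "q_map G H f"
begin

abbreviation "DG \<equiv> commutator_subgroup G (carrier G) (carrier G)"
abbreviation "DH \<equiv> commutator_subgroup H (carrier H) (carrier H)"
abbreviation "B \<equiv> cross_effect G H f"

sublocale DG: subgroup DG G
  by (rule G.commutator_subgroup_is_subgroup) auto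

sublocale DH: subgroup DH H
  by (rule H.commutator_subgroup_is_subgroup) auto

lemmas DG_carrier = DG.mem_carrier and DH_carrier = DH.mem_carrier

lemma f_closed [simp]: "a \<in> carrier G \<Longrightarrow> f a \<in> carrier H"
  using q_map by (auto simp: q_map_def weakly_quadratic_def)

lemma B_DH: "a \<in> carrier G \<Longrightarrow> b \<in> carrier G \<Longrightarrow> B a b \<in> DH"
  using q_map by (auto simp: q_map_def)

lemma B_closed [simp]: "a \<in> carrier G \<Longrightarrow> b \<in> carrier G \<Longrightarrow> B a b \<in> carrier H"
  using B_DH by (rule DH_carrier)

lemma DH_commute: "z \<in> DH \<Longrightarrow> x \<in> carrier H \<Longrightarrow> z \<otimes>\<^bsub>H\<^esub> x = x \<otimes>\<^bsub>H\<^esub> z"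
  using nil2 by (rule nil2_group_central)

lemma B_hom_left: "b \<in> carrier G \<Longrightarrow> (\<lambda>a. B a b) \<in> hom G H"
  and B_hom_right: "a \<in> carrier G \<Longrightarrow> B a \<in> hom G H"
  using q_map by (simp_all add: q_map_def weakly_quadratic_def)

lemma B_mult_left:
  "\<lbrakk>a \<in> carrier G; a' \<in> carrier G; b \<in> carrier G\<rbrakk> \<Longrightarrow> B (a \<otimes>\<^bsub>G\<^esub> a') b = B a b \<otimes>\<^bsub>H\<^esub> B a' b"
  by (rule hom_mult[OF B_hom_left])

lemma B_mult_right:
  "\<lbrakk>a \<in> carrier G; b \<in> carrier G; b' \<in> carrier G\<rbrakk> \<Longrightarrow> B a (b \<otimes>\<^bsub>G\<^esub> b') = B a b \<otimes>\<^bsub>H\<^esub> B a b'"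
  by (rule hom_mult[OF B_hom_right])

text \<open>For fixed \<open>b\<close> this is a homomorphism whose values lie in the central
  subgroup \<open>DH\<close>, hence commute, so its kernel contains \<open>DG\<close>.\<close>

lemma B_derived_left:
  assumes "z \<in> DG" and b: "b \<in> carrier G"
  shows "B z b = \<one>\<^bsub>H\<^esub>"
proof -
  interpret group_hom G H "\<lambda>a. B a b"
    by (unfold_locales) (rule B_hom_left[OF b])
  show ?thesis
    using assms commutator_subgroup_subset_kernel DH_commute B_DH by (auto simp: kernel_def)
qed

lemma B_derived_right:
  assumes "z \<in> DG" and a: "a \<in> carrier G"
  shows "B a z = \<one>\<^bsub>H\<^esub>"
proof -
  interpret group_hom G H "B a"
    by (unfold_locales) (rule B_hom_right[OF a])
  show ?thesis
    using assms commutator_subgroup_subset_kernel DH_commute B_DH by (auto simp: kernel_def)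
qed

lemma f_mult:
  assumes "a \<in> carrier G" "b \<in> carrier G"
  shows "f (a \<otimes>\<^bsub>G\<^esub> b) = f a \<otimes>\<^bsub>H\<^esub> f b \<otimes>\<^bsub>H\<^esub> B a b"
  using assms by (simp add: cross_effect_def flip: H.m_assoc)

text \<open>The correction term \<open>B x z\<close> in \<open>f_mult\<close> is trivial by
  \<open>B_derived_right\<close>.\<close>

lemma f_mult_derived:
  "x \<in> carrier G \<Longrightarrow> z \<in> DG \<Longrightarrow> f (x \<otimes>\<^bsub>G\<^esub> z) = f x \<otimes>\<^bsub>H\<^esub> f z"
  using f_mult[of x z] by (simp add: B_derived_right DG_carrier)

lemma f_one: "f \<one>\<^bsub>G\<^esub> = \<one>\<^bsub>H\<^esub>"
  using f_mult_derived[of "\<one>\<^bsub>G\<^esub>" "\<one>\<^bsub>G\<^esub>"] by simp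

text \<open>Compares two expansions of \<open>f (a + b)\<close>: one exchanges \<open>f a\<close>
  and \<open>f b\<close> in \<open>H\<close>, the other exchanges \<open>a\<close> and
  \<open>b\<close> in \<open>G\<close> before \<open>f\<close> is applied.\<close>

lemma f_commutator:
  assumes "a \<in> carrier G" "b \<in> carrier G"
  shows "f (commutator G a b) = commutator H (f a) (f b) \<otimes>\<^bsub>H\<^esub> (B a b \<otimes>\<^bsub>H\<^esub> inv\<^bsub>H\<^esub> B b a)"
proof -
  let ?c = "commutator H (f a) (f b)" and ?d = "f (commutator G a b)"
  have "f b \<otimes>\<^bsub>H\<^esub> f a \<otimes>\<^bsub>H\<^esub> ?c \<otimes>\<^bsub>H\<^esub> B a b = f (a \<otimes>\<^bsub>G\<^esub> b)"
    using assms by (simp add: f_mult flip: H.mult_eq_mult_commutator)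
  \<comment> \<open>Here \<open>a + b = b + a + [a, b]\<close>, and \<open>f\<close> splits off the
    last summand because it lies in \<open>DG\<close>.\<close>
  also have "\<dots> = f (b \<otimes>\<^bsub>G\<^esub> a) \<otimes>\<^bsub>H\<^esub> ?d"
    using assms
    by (subst G.mult_eq_mult_commutator)
      (auto intro!: f_mult_derived commutator_in_commutator_subgroup)
  \<comment> \<open>Centrality moves \<open>B b a\<close> past \<open>?d\<close>, so that the common
    left factor \<open>f b + f a\<close> can be cancelled.\<close>
  also have "\<dots> = f b \<otimes>\<^bsub>H\<^esub> f a \<otimes>\<^bsub>H\<^esub> (?d \<otimes>\<^bsub>H\<^esub> B b a)"
    using assms by (simp add: f_mult H.m_assoc DH_commute[OF B_DH])
  finally have "?c \<otimes>\<^bsub>H\<^esub> B a b = ?d \<otimes>\<^bsub>H\<^esub> B b a"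
    using assms by (simp add: H.m_assoc)
  then show ?thesis
    using assms by (simp add: H.inv_solve_right flip: H.m_assoc)
qed

text \<open>On \<open>DG\<close> the map \<open>f\<close> is additive, so the elements sent into
  \<open>DH\<close> form a subgroup; it contains every commutator because all terms of
  \<open>f_commutator\<close> lie in \<open>DH\<close>.\<close>

lemma f_derived: "z \<in> DG \<Longrightarrow> f z \<in> DH"
proof -
  have "DG \<subseteq> {z \<in> DG. f z \<in> DH}"
  proof (rule G.commutator_subgroup_least)
    \<comment> \<open>The set retains \<open>z \<in> DG\<close> because
      \<open>f_mult_derived\<close> asks for the right summand to lie in \<open>DG\<close>.\<close>
    show "subgroup {z \<in> DG. f z \<in> DH} G"
    proof (rule G.subgroupI)
      fix z assume z: "z \<in> {z \<in> DG. f z \<in> DH}"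
      then have "f z \<otimes>\<^bsub>H\<^esub> f (inv\<^bsub>G\<^esub> z) = \<one>\<^bsub>H\<^esub>"
        using f_mult_derived[of z "inv\<^bsub>G\<^esub> z"] by (simp add: f_one DG_carrier)
      then have "f (inv\<^bsub>G\<^esub> z) = inv\<^bsub>H\<^esub> f z"
        using z by (metis (no_types, lifting) DG_carrier G.inv_closed H.inv_comm H.inv_equality
            f_closed mem_Collect_eq)
      then show "inv\<^bsub>G\<^esub> z \<in> {z \<in> DG. f z \<in> DH}"
        using z by simp
    qed (auto simp: f_mult_derived DG_carrier f_one intro: exI[of _ "\<one>\<^bsub>G\<^esub>"])
    show "commutator G a b \<in> {z \<in> DG. f z \<in> DH}"
      if "a \<in> carrier G" "b \<in> carrier G" for a b
      using that by (simp add: f_commutator B_DH commutator_in_commutator_subgroup)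
  qed
  then show "z \<in> DG \<Longrightarrow> f z \<in> DH"
    by blast
qed

end

theorem proposition4p1:
  fixes G1 :: "('a, 'm) monoid_scheme"
    and G :: "('b, 'n) monoid_scheme"
    and H :: "('c, 'k) monoid_scheme"
    and f :: "'b \<Rightarrow> 'c" and g :: "'a \<Rightarrow> 'b"
  assumes "nil2_group G1" and "nil2_group G" and "nil2_group H"
    and "q_map G H f" and "q_map G1 G g"
  shows "q_map G1 H (f \<circ> g) \<and>
    (\<forall>a\<in>carrier G1. \<forall>b\<in>carrier G1.
       cross_effect G1 H (f \<circ> g) a b =
         f (cross_effect G1 G g a b) \<otimes>\<^bsub>H\<^esub> cross_effect G H f (g a) (g b))"
proof -
  interpret g: nil2_q_map G1 G g
    using assms by (simp add: nil2_q_map_def nil2_q_map_axioms_def nil2_group_is_group)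
  interpret f: nil2_q_map G H f
    using assms by (simp add: nil2_q_map_def nil2_q_map_axioms_def nil2_group_is_group)
  let ?C = "cross_effect G1 H (f \<circ> g)"
  have C: "?C a b = f (g.B a b) \<otimes>\<^bsub>H\<^esub> f.B (g a) (g b)"
    if ab: "a \<in> carrier G1" "b \<in> carrier G1" for a b
  proof -
    \<comment> \<open>Expand \<open>g (a + b) = g a + g b + (a | b)\<close> for the cross-effect of
      \<open>g\<close>. The last summand lies in \<open>[G, G]\<close>, so \<open>f\<close> splits
      it off without correction.\<close>
    have "f (g (a \<otimes>\<^bsub>G1\<^esub> b)) = f (g a) \<otimes>\<^bsub>H\<^esub> f (g b) \<otimes>\<^bsub>H\<^esub> (f.B (g a) (g b) \<otimes>\<^bsub>H\<^esub> f (g.B a b))"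
      using ab by (simp add: g.f_mult f.f_mult_derived g.B_DH f.f_mult f.H.m_assoc)
    also have "f.B (g a) (g b) \<otimes>\<^bsub>H\<^esub> f (g.B a b) = f (g.B a b) \<otimes>\<^bsub>H\<^esub> f.B (g a) (g b)"
      using ab by (simp add: f.DH_commute f.B_DH)
    finally show ?thesis
      using ab by (simp add: cross_effect_def[of G1 H] f.H.inv_solve_left')
  qed
  have C_DH: "?C a b \<in> f.DH" if "a \<in> carrier G1" "b \<in> carrier G1" for a b
    using that by (simp add: C f.f_derived f.B_DH g.B_DH)
  have left: "(\<lambda>a. ?C a b) \<in> hom G1 H" if b: "b \<in> carrier G1" for b
  proof (rule homI)
    fix a a' assume a: "a \<in> carrier G1" "a' \<in> carrier G1"
    \<comment> \<open>The cross-effect of \<open>g\<close> inside \<open>g (a + a')\<close> lies in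
      \<open>[G, G]\<close>, so \<open>f.B_derived_left\<close> removes its contribution and
      \<open>f.B\<close> sees only \<open>g a + g a'\<close>.\<close>
    have "?C (a \<otimes>\<^bsub>G1\<^esub> a') b
      = f (g.B a b) \<otimes>\<^bsub>H\<^esub> (f (g.B a' b) \<otimes>\<^bsub>H\<^esub> f.B (g a) (g b)) \<otimes>\<^bsub>H\<^esub> f.B (g a') (g b)"
      using a b by (simp add: C g.B_mult_left g.f_mult f.f_mult_derived g.B_DH f.B_mult_left
          f.B_derived_left f.H.m_assoc)
    \<comment> \<open>Exchanging the two middle factors regroups the product as
      \<open>?C a b\<close> followed by \<open>?C a' b\<close>.\<close>
    also have "f (g.B a' b) \<otimes>\<^bsub>H\<^esub> f.B (g a) (g b) = f.B (g a) (g b) \<otimes>\<^bsub>H\<^esub> f (g.B a' b)"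
      using a b by (intro f.DH_commute f.f_derived g.B_DH f.B_closed g.f_closed)
    finally show "?C (a \<otimes>\<^bsub>G1\<^esub> a') b = ?C a b \<otimes>\<^bsub>H\<^esub> ?C a' b"
      using a b by (simp add: C[of a] C[of a'] f.H.m_assoc del: comp_apply)
  qed (use b C_DH f.DH_carrier in blast)
  have right: "?C a \<in> hom G1 H" if a: "a \<in> carrier G1" for a
  proof (rule homI)
    fix b b' assume b: "b \<in> carrier G1" "b' \<in> carrier G1"
    have "?C a (b \<otimes>\<^bsub>G1\<^esub> b')
      = f (g.B a b) \<otimes>\<^bsub>H\<^esub> (f (g.B a b') \<otimes>\<^bsub>H\<^esub> f.B (g a) (g b)) \<otimes>\<^bsub>H\<^esub> f.B (g a) (g b')"
      using a b by (simp add: C g.B_mult_right g.f_mult f.f_mult_derived g.B_DH f.B_mult_right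
          f.B_derived_right f.H.m_assoc)
    also have "f (g.B a b') \<otimes>\<^bsub>H\<^esub> f.B (g a) (g b) = f.B (g a) (g b) \<otimes>\<^bsub>H\<^esub> f (g.B a b')"
      using a b by (intro f.DH_commute f.f_derived g.B_DH f.B_closed g.f_closed)
    finally show "?C a (b \<otimes>\<^bsub>G1\<^esub> b') = ?C a b \<otimes>\<^bsub>H\<^esub> ?C a b'"
      using a b by (simp add: C[of _ b] C[of _ b'] f.H.m_assoc del: comp_apply)
  qed (use a C_DH f.DH_carrier in blast)
  \<comment> \<open>The commutation condition holds because the values of \<open>?C\<close> lie in
    the central subgroup \<open>[H, H]\<close>.\<close>
  have "weakly_quadratic G1 H (f \<circ> g)"
    using left right by (auto simp: weakly_quadratic_def f.DH_commute C_DH)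
  then show ?thesis
    using C C_DH by (simp add: q_map_def)
qed

end
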